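(* Let $G_{14}$ be the graph with the $14$ vertices $\{a,b,c,d\}\cup\{u_0,u_1,u_2,u_3,u_4\}\cup\{v_0,v_1,v_2,v_3,v_4\}$ (all distinct) and the following $16$ edges: the square edges $ab, bc, cd, da$; the pentagon edges $u_0u_1, u_1u_2, u_2u_3, u_3u_4, u_4u_0$; the pentagon edges $v_0v_1, v_1v_2, v_2v_3, v_3v_4, v_4v_0$; and the two bridges $au_0$ and $bv_0$. Then the line graph $L(G_{14})$ has inertia $\mathrm{In}(L(G_{14})) = (9,0,7)$. Hence $s(L(G_{14})) = 2$, and the assertion "for every connected graph $G$, $n^{+}(L(G)) \le n^{-}(L(G)) + 1$" is false.
   Context: All graphs are finite and simple. For a graph $H$ with adjacency matrix $A(H)$, $n^{+}(H)$, $n^{0}(H)$, $n^{-}(H)$ denote the numbers of positive, zero and negative eigenvalues of $A(H)$, counted with multiplicity; the inertia is $\mathrm{In}(H) = (n^{+}(H), n^{0}(H), n^{-}(H))$ and the signature is $s(H) = n^{+}(H) - n^{-}(H)$. The line graph $L(G)$ has the edges of $G$ as vertices, two being adjacent when they are distinct and share an endpoint. *)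

theory Defs
  imports
    "Graph_Theory.Graph_Theory"
    "Jordan_Normal_Form.Char_Poly"
begin

text \<open>
  A finite simple graph is a \<^const>\<open>pair_graph\<close>: finite vertex set, irreflexive symmetric
  arc relation, so each undirected edge \<open>xy\<close> is represented by the two arcs \<open>(x, y)\<close>, \<open>(y, x)\<close>.
\<close>

definition graph_of_edges :: "'v set \<Rightarrow> ('v \<times> 'v) set \<Rightarrow> 'v pair_pre_digraph" where
  "graph_of_edges V E = \<lparr> pverts = V, parcs = E \<union> E\<inverse> \<rparr>"

definition edges :: "'v pair_pre_digraph \<Rightarrow> 'v set set" where
  "edges G = {{x, y} | x y. (x, y) \<in> parcs G}"

definition line_graph :: "'v pair_pre_digraph \<Rightarrow> 'v set pair_pre_digraph" where
  "line_graph G =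
    \<lparr> pverts = edges G,
      parcs = {(e, f). e \<in> edges G \<and> f \<in> edges G \<and> e \<noteq> f \<and> e \<inter> f \<noteq> {}} \<rparr>"

definition adjacency_matrix_wrt :: "'v list \<Rightarrow> 'v pair_pre_digraph \<Rightarrow> real mat" where
  "adjacency_matrix_wrt vs G =
    mat (length vs) (length vs) (\<lambda>(i, j). if (vs ! i, vs ! j) \<in> parcs G then 1 else 0)"

text \<open>
  The vertices are enumerated in an arbitrary order; the spectrum does not depend on it, see
  \<open>char_poly_adjacency_matrix\<close> and \<open>eigenvalue_count_wrt\<close> below.
\<close>

definition adjacency_matrix :: "'v pair_pre_digraph \<Rightarrow> real mat" where
  "adjacency_matrix G =
    adjacency_matrix_wrt (SOME vs. distinct vs \<and> set vs = pverts G) G"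

text \<open>
  Number of eigenvalues satisfying \<open>P\<close>, each counted with its multiplicity as a root of the
  characteristic polynomial.
\<close>

definition eigenvalue_count :: "(real \<Rightarrow> bool) \<Rightarrow> real mat \<Rightarrow> nat" where
  "eigenvalue_count P A = (\<Sum>x | eigenvalue A x \<and> P x. order x (char_poly A))"

definition n_pos :: "'v pair_pre_digraph \<Rightarrow> nat" where
  "n_pos H = eigenvalue_count (\<lambda>x. x > 0) (adjacency_matrix H)"

definition n_zero :: "'v pair_pre_digraph \<Rightarrow> nat" where
  "n_zero H = eigenvalue_count (\<lambda>x. x = 0) (adjacency_matrix H)"

definition n_neg :: "'v pair_pre_digraph \<Rightarrow> nat" where
  "n_neg H = eigenvalue_count (\<lambda>x. x < 0) (adjacency_matrix H)"

definition inertia :: "'v pair_pre_digraph \<Rightarrow> nat \<times> nat \<times> nat" where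
  "inertia H = (n_pos H, n_zero H, n_neg H)"

definition signature :: "'v pair_pre_digraph \<Rightarrow> int" where
  "signature H = int (n_pos H) - int (n_neg H)"

definition G14 ::
    "'v \<Rightarrow> 'v \<Rightarrow> 'v \<Rightarrow> 'v \<Rightarrow> (nat \<Rightarrow> 'v) \<Rightarrow> (nat \<Rightarrow> 'v) \<Rightarrow> 'v pair_pre_digraph" where
  "G14 a b c d u v = graph_of_edges
    ({a, b, c, d} \<union> {u 0, u 1, u 2, u 3, u 4} \<union> {v 0, v 1, v 2, v 3, v 4})
    ({(a, b), (b, c), (c, d), (d, a)} \<union>
     {(u 0, u 1), (u 1, u 2), (u 2, u 3), (u 3, u 4), (u 4, u 0)} \<union>
     {(v 0, v 1), (v 1, v 2), (v 2, v 3), (v 3, v 4), (v 4, v 0)} \<union>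
     {(a, u 0), (b, v 0)})"

lemma pair_graph_graph_of_edges:
  assumes "finite V" "E \<subseteq> V \<times> V" "\<And>x. (x, x) \<notin> E"
  shows "pair_graph (graph_of_edges V E)"
proof -
  have "finite E" using assms finite_subset by blast
  then show ?thesis
    using assms by unfold_locales
      (auto simp: graph_of_edges_def symmetric_def arcs_ends_def arc_to_ends_def intro!: symI)
qed

lemma pair_graph_G14:
  assumes "distinct [a, b, c, d, u 0, u 1, u 2, u 3, u 4, v 0, v 1, v 2, v 3, v 4]"
  shows "pair_graph (G14 a b c d u v)"
  unfolding G14_def using assms
  by (intro pair_graph_graph_of_edges) auto

lemma pair_graph_line_graph:
  assumes "pair_graph G"
  shows "pair_graph (line_graph G)"
proof -
  interpret pair_graph G by fact
  have "edges G = (\<lambda>(x, y). {x, y}) ` parcs G"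
    by (auto simp: edges_def image_iff)
  then have fin: "finite (edges G)"
    using finite_arcs by simp
  have "parcs (line_graph G) \<subseteq> edges G \<times> edges G"
    by (auto simp: line_graph_def)
  then have "finite (parcs (line_graph G))"
    using fin finite_subset by blast
  then show ?thesis
    using fin by unfold_locales
      (auto simp: line_graph_def symmetric_def arcs_ends_def arc_to_ends_def intro!: symI)
qed

lemma similar_adjacency_matrix_wrt:
  assumes vs: "distinct vs" and ws: "distinct ws" and eq: "set vs = set ws"
  shows "similar_mat (adjacency_matrix_wrt vs G) (adjacency_matrix_wrt ws G)"
proof -
  define n where "n = length vs"
  have n: "length vs = n" "length ws = n"
    using distinct_card[OF vs] distinct_card[OF ws] eq by (auto simp: n_def)
  define P :: "real mat" where "P = mat n n (\<lambda>(i, j). if vs ! i = ws ! j then 1 else 0)"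
  define Q :: "real mat" where "Q = mat n n (\<lambda>(i, j). if ws ! i = vs ! j then 1 else 0)"
  have ex: "\<exists>j<n. vs ! i = ws ! j" if "i < n" for i
  proof -
    have "vs ! i \<in> set ws" using that n eq nth_mem by metis
    then show ?thesis using n by (auto simp: in_set_conv_nth)
  qed
  have inj: "vs ! i = vs ! j \<longleftrightarrow> i = j" "ws ! i = ws ! j \<longleftrightarrow> i = j" if "i < n" "j < n" for i j
    using that vs ws n by (simp_all add: nth_eq_iff_index_eq)
  have pick: "(\<Sum>k = 0..<n. (if k = l then 1 else 0) * f k) = f l"
    "(\<Sum>k = 0..<n. f k * (if k = l then 1 else 0)) = f l" if "l < n" for l and f :: "nat \<Rightarrow> real"
  proof -
    have "(\<Sum>k = 0..<n. (if k = l then 1 else 0) * f k) = (\<Sum>k = 0..<n. if k = l then f k else 0)"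
      by (rule sum.cong) simp_all
    also have "\<dots> = f l" using that by simp
    finally show "(\<Sum>k = 0..<n. (if k = l then 1 else 0) * f k) = f l" .
    then show "(\<Sum>k = 0..<n. f k * (if k = l then 1 else 0)) = f l"
      by (simp add: mult.commute)
  qed
  have PQ: "P * Q = 1\<^sub>m n"
  proof (rule eq_matI)
    fix i j assume "i < dim_row (1\<^sub>m n :: real mat)" "j < dim_col (1\<^sub>m n :: real mat)"
    then have ij: "i < n" "j < n" by auto
    obtain l where l: "l < n" "vs ! i = ws ! l" using ex ij by blast
    have "(P * Q) $$ (i, j) = (\<Sum>k = 0..<n. (if k = l then 1 else 0) * (if ws ! k = vs ! j then 1 else 0))"
      using ij l by (auto simp: P_def Q_def scalar_prod_def inj intro!: sum.cong)
    also have "\<dots> = (if ws ! l = vs ! j then 1 else 0)" using pick(1)[OF l(1)] by simp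
    finally show "(P * Q) $$ (i, j) = 1\<^sub>m n $$ (i, j)" using ij l(2)[symmetric] inj by simp
  qed (auto simp: P_def Q_def)
  have QP: "Q * P = 1\<^sub>m n"
    using PQ by (intro mat_mult_left_right_inverse[of P n Q]) (auto simp: P_def Q_def)
  have "adjacency_matrix_wrt vs G = P * adjacency_matrix_wrt ws G * Q" (is "?A = P * ?B * Q")
  proof (rule eq_matI)
    fix i j assume "i < dim_row (P * ?B * Q)" "j < dim_col (P * ?B * Q)"
    then have ij: "i < n" "j < n" by (auto simp: P_def Q_def)
    obtain l where l: "l < n" "vs ! i = ws ! l" using ex ij by blast
    obtain m where m: "m < n" "vs ! j = ws ! m" using ex ij by blast
    have PB: "(P * ?B) $$ (i, k) = ?B $$ (l, k)" if k: "k < n" for k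
    proof -
      have "(P * ?B) $$ (i, k) = (\<Sum>r = 0..<n. (if r = l then 1 else 0) * ?B $$ (r, k))"
        using ij l k n
        by (auto simp: P_def adjacency_matrix_wrt_def scalar_prod_def inj intro!: sum.cong)
      then show ?thesis using pick(1)[OF l(1)] by simp
    qed
    have "(P * ?B * Q) $$ (i, j) = (\<Sum>k = 0..<n. (P * ?B) $$ (i, k) * Q $$ (k, j))"
      using ij n by (simp add: P_def Q_def adjacency_matrix_wrt_def scalar_prod_def)
    also have "\<dots> = (\<Sum>k = 0..<n. ?B $$ (l, k) * (if k = m then 1 else 0))"
      using ij m PB by (intro sum.cong) (auto simp: Q_def inj)
    also have "\<dots> = ?B $$ (l, m)" using pick(2)[OF m(1)] by simp
    also have "\<dots> = ?A $$ (i, j)"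
      using ij l m n by (simp add: adjacency_matrix_wrt_def)
    finally show "?A $$ (i, j) = (P * ?B * Q) $$ (i, j)" by simp
  qed (auto simp: P_def Q_def adjacency_matrix_wrt_def n)
  then have "similar_mat_wit ?A ?B P Q"
    using PQ QP n
    by (intro similar_mat_witI[of P Q n]) (auto simp: P_def Q_def adjacency_matrix_wrt_def)
  then show ?thesis by (auto simp: similar_mat_def)
qed

lemma char_poly_adjacency_matrix:
  assumes "distinct vs" "set vs = pverts G"
  shows "char_poly (adjacency_matrix G) = char_poly (adjacency_matrix_wrt vs G)"
proof -
  let ?ws = "SOME vs. distinct vs \<and> set vs = pverts G"
  have ws: "distinct ?ws \<and> set ?ws = pverts G"
    by (rule someI[where P = "\<lambda>vs. distinct vs \<and> set vs = pverts G"], rule conjI[OF assms])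
  have "similar_mat (adjacency_matrix_wrt ?ws G) (adjacency_matrix_wrt vs G)"
    by (rule similar_adjacency_matrix_wrt) (simp_all only: ws assms)
  then show ?thesis
    unfolding adjacency_matrix_def by (rule char_poly_similar)
qed

lemma eigenvalue_count_wrt:
  assumes "distinct vs" "set vs = pverts G"
  shows "eigenvalue_count P (adjacency_matrix G) = eigenvalue_count P (adjacency_matrix_wrt vs G)"
proof -
  have sq: "adjacency_matrix G \<in> carrier_mat (dim_row (adjacency_matrix G)) (dim_row (adjacency_matrix G))"
    "adjacency_matrix_wrt vs G \<in> carrier_mat (length vs) (length vs)"
    by (auto simp: adjacency_matrix_def adjacency_matrix_wrt_def)
  show ?thesis
    using char_poly_adjacency_matrix[OF assms]
    by (simp add: eigenvalue_count_def eigenvalue_root_char_poly[OF sq(1)]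
        eigenvalue_root_char_poly[OF sq(2)])
qed

end

theory Submission
  imports Defs
begin

text \<open>
  In a basis adapted to the symmetries of \<open>G14\<close> (one reflection of each pentagon and the swap
  of the two pentagons) the adjacency matrix of the line graph splits into blocks of sizes
  2, 2, 5 and 7, with characteristic polynomial
  \<open>(x\<^sup>2 + x - 1)\<^sup>2 (x\<^sup>5 - x\<^sup>4 - 6x\<^sup>3 + 3x\<^sup>2 + 7x - 2) (x + 2)\<^sup>2 (x - 1) (x - 2) (x\<^sup>3 - 2x\<^sup>2 - 4x + 1)\<close>.
  Sign changes of the factors at small rational points exhibit at least 9 positive and 7 negative
  roots, which exhausts the degree 16.
\<close>

section \<open>Matrices given by rows, with products and determinants that evaluate\<close>

definition sq_mat :: "'a list list \<Rightarrow> 'a mat" where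
  "sq_mat rs = mat_of_rows_list (length rs) rs"

definition square_rows :: "'a list list \<Rightarrow> bool" where
  "square_rows rs \<longleftrightarrow> (\<forall>r\<in>set rs. length r = length rs)"

lemma sq_mat_carrier [simp]: "sq_mat rs \<in> carrier_mat (length rs) (length rs)"
  by (simp add: sq_mat_def mat_of_rows_list_def)

lemma sq_mat_dim [simp]: "dim_row (sq_mat rs) = length rs" "dim_col (sq_mat rs) = length rs"
  by (simp_all add: sq_mat_def mat_of_rows_list_def)

lemma sq_mat_index [simp]:
  "i < length rs \<Longrightarrow> j < length rs \<Longrightarrow> sq_mat rs $$ (i, j) = rs ! i ! j"
  by (simp add: sq_mat_def mat_of_rows_list_def)

lemma square_rows_length: "square_rows rs \<Longrightarrow> i < length rs \<Longrightarrow> length (rs ! i) = length rs"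
  by (simp add: square_rows_def)

definition rows_mult :: "'a::comm_ring_1 list list \<Rightarrow> 'a list list \<Rightarrow> 'a list list" where
  "rows_mult R S =
     (let Cs = map (\<lambda>j. map (\<lambda>s. s ! j) S) [0..<length S]
      in map (\<lambda>r. map (\<lambda>c. sum_list (map2 (*) r c)) Cs) R)"

lemma sq_mat_mult:
  assumes R: "square_rows R" and len: "length S = length R"
  shows "sq_mat R * sq_mat S = sq_mat (rows_mult R S)"
proof (rule eq_matI)
  fix i j assume "i < dim_row (sq_mat (rows_mult R S))" "j < dim_col (sq_mat (rows_mult R S))"
  then have ij: "i < length R" "j < length R" by (simp_all add: rows_mult_def)
  have "(sq_mat R * sq_mat S) $$ (i, j) = (\<Sum>k<length R. R ! i ! k * S ! k ! j)"
    using ij len by (simp add: scalar_prod_def atLeast0LessThan)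
  also have "\<dots> = sum_list (map2 (*) (R ! i) (map (\<lambda>r. r ! j) S))"
    using ij len square_rows_length[OF R]
    by (simp add: sum_list_sum_nth atLeast0LessThan)
  also have "\<dots> = sq_mat (rows_mult R S) $$ (i, j)"
    using ij len by (simp add: rows_mult_def)
  finally show "(sq_mat R * sq_mat S) $$ (i, j) = sq_mat (rows_mult R S) $$ (i, j)" .
qed (simp_all add: rows_mult_def len)

text \<open>Laplace expansion along the first row. The test for a zero entry prunes the recursion,
  which keeps the expansion of sparse matrices small.\<close>

fun det_rows :: "'a::comm_ring_1 list list \<Rightarrow> 'a" where
  "det_rows [] = 1"
| "det_rows (r # rs) = (\<Sum>j\<leftarrow>[0..<length r]. if r ! j = 0 then 0
     else (- 1) ^ j * r ! j * det_rows (map (\<lambda>s. take j s @ drop (Suc j) s) rs))"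

lemma det_sq_mat:
  "square_rows rs \<Longrightarrow> det (sq_mat rs) = det_rows rs"
proof (induction "length rs" arbitrary: rs)
  case 0
  then show ?case by (simp add: sq_mat_def mat_of_rows_list_def)
next
  case (Suc n)
  then obtain r rs' where rs: "rs = r # rs'" by (cases rs) auto
  have len: "length r = Suc n" "length rs' = n" "\<And>s. s \<in> set rs' \<Longrightarrow> length s = Suc n"
    using Suc.prems Suc.hyps(2) rs by (auto simp: square_rows_def)
  let ?minor = "\<lambda>j. map (\<lambda>s. take j s @ drop (Suc j) s) rs'"
  \<comment> \<open>Deleting row 0 and column \<open>j\<close> leaves the tail \<open>rs'\<close>
    with entry \<open>j\<close> cut out of each row, again a square list, so the induction
    hypothesis applies to the minors.\<close>
  have minor: "mat_delete (sq_mat rs) 0 j = sq_mat (?minor j)" if "j < Suc n" for j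
    by (rule eq_matI)
      (use that len in \<open>auto simp: mat_delete_def rs nth_append\<close>)
  have IH: "det (sq_mat (?minor j)) = det_rows (?minor j)" if "j < Suc n" for j
    using that len by (intro Suc.hyps(1)) (auto simp: square_rows_def)
  have "det (sq_mat rs) = (\<Sum>j<Suc n. sq_mat rs $$ (0, j) * cofactor (sq_mat rs) 0 j)"
    using Suc.hyps(2) by (intro laplace_expansion_row) auto
  also have "\<dots> = (\<Sum>j<Suc n. if r ! j = 0 then 0 else (- 1) ^ j * r ! j * det_rows (?minor j))"
    using len by (intro sum.cong) (auto simp: cofactor_def minor IH, auto simp: rs)
  also have "\<dots> = det_rows rs"
    using len by (auto simp: rs sum_list_sum_nth atLeast0LessThan
        simp del: upt_Suc sum.lessThan_Suc intro!: sum.cong)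
  finally show ?case .
qed

text \<open>The rows of \<open>x I - A\<close>, with polynomials as entries.\<close>

definition char_rows :: "'a::comm_ring_1 list list \<Rightarrow> 'a poly list list" where
  "char_rows rs = map (\<lambda>i. map (\<lambda>j. [:- (rs ! i ! j), if i = j then 1 else 0:]) [0..<length rs])
     [0..<length rs]"

lemma char_poly_sq_mat: "char_poly (sq_mat rs) = det_rows (char_rows rs)"
proof -
  have "char_poly_matrix (sq_mat rs) = sq_mat (char_rows rs)"
    by (rule eq_matI) (auto simp: char_poly_matrix_def char_rows_def)
  then show ?thesis
    by (simp add: char_poly_def det_sq_mat square_rows_def char_rows_def)
qed

section \<open>Block diagonal matrices\<close>

lemma char_poly_four_block_diag:
  fixes A B :: "'a::idom mat"
  assumes A: "A \<in> carrier_mat n n" and B: "B \<in> carrier_mat m m"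
  shows "char_poly (four_block_mat A (0\<^sub>m n m) (0\<^sub>m m n) B) = char_poly A * char_poly B"
proof -
  have "char_poly_matrix (four_block_mat A (0\<^sub>m n m) (0\<^sub>m m n) B) =
    four_block_mat (char_poly_matrix A) (0\<^sub>m n m) (0\<^sub>m m n) (char_poly_matrix B)"
    using A B by (intro eq_matI) (auto simp: char_poly_matrix_def)
  then show ?thesis
    using A B by (simp add: char_poly_def det_four_block_mat_lower_left_zero[of _ n _ m])
qed

text \<open>The length of a block serves as both its height and its width, so the padding is right
  for square blocks.\<close>

fun diag_rows :: "'a::zero list list list \<Rightarrow> 'a list list" where
  "diag_rows [] = []"
| "diag_rows (M # Ms) = (let N = diag_rows Ms in
     map (\<lambda>r. r @ replicate (length N) 0) M @ map (\<lambda>r. replicate (length M) 0 @ r) N)"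

lemma square_rows_diag_rows:
  "\<forall>M\<in>set Ms. square_rows M \<Longrightarrow> square_rows (diag_rows Ms)"
  by (induction Ms) (auto simp: square_rows_def Let_def)

lemma char_poly_diag_rows:
  fixes Ms :: "'a::idom list list list"
  shows "\<forall>M\<in>set Ms. square_rows M \<Longrightarrow>
    char_poly (sq_mat (diag_rows Ms)) = (\<Prod>M\<leftarrow>Ms. char_poly (sq_mat M))"
proof (induction Ms)
  case Nil
  then show ?case by (simp add: char_poly_sq_mat char_rows_def)
next
  case (Cons M Ms)
  let ?N = "diag_rows Ms"
  have sq: "square_rows M" "square_rows ?N"
    using Cons.prems square_rows_diag_rows[of Ms] by auto
  have "sq_mat (diag_rows (M # Ms)) = four_block_mat (sq_mat M)
      (0\<^sub>m (length M) (length ?N)) (0\<^sub>m (length ?N) (length M)) (sq_mat ?N)"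
    by (rule eq_matI)
      (use sq in \<open>auto simp: Let_def nth_append square_rows_length\<close>)
  then show ?case
    using Cons by (simp add: char_poly_four_block_diag)
qed

section \<open>Counting roots by sign\<close>

text \<open>The order of a root is its count in \<open>proots\<close>. In this form eigenvalue
  counts add up over the factors of the characteristic polynomial.\<close>

lemma eigenvalue_count_proots:
  assumes "A \<in> carrier_mat n n"
  shows "eigenvalue_count P A = size (filter_mset P (proots (char_poly A)))"
proof -
  have nz: "char_poly A \<noteq> 0"
    using degree_monic_char_poly[OF assms] by auto
  have "set_mset (filter_mset P (proots (char_poly A))) = {x. eigenvalue A x \<and> P x}"
    using nz by (auto simp: eigenvalue_root_char_poly[OF assms])
  then show ?thesis
    unfolding eigenvalue_count_def size_multiset_overloaded_eq
    using nz by (intro sum.cong) auto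
qed

text \<open>The intermediate value theorem gives a root strictly between any two consecutive sample
  points, and these open intervals are disjoint.\<close>

lemma sign_changes_le_proots:
  fixes p :: "real poly"
  assumes "p \<noteq> 0" "successively (\<lambda>x y. x < y \<and> poly p x * poly p y < 0) (x # xs)"
  shows "length xs \<le> size {#z \<in># proots p. x < z \<and> z < last (x # xs)#}"
  using assms(2)
proof (induction xs arbitrary: x)
  case Nil
  then show ?case by simp
next
  case (Cons y ys)
  let ?I = "\<lambda>a b. {#z \<in># proots p. a < z \<and> z < b#}"
  let ?b = "last (y # ys)"
  have xy: "x < y" "poly p x * poly p y < 0"
    and succ: "successively (\<lambda>x y. x < y \<and> poly p x * poly p y < 0) (y # ys)"
    using Cons.prems by auto
  have "successively (<) (y # ys)"
    using succ by (rule successively_mono) simp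
  then have "sorted_wrt (<) (y # ys)"
    by (simp add: successively_conv_sorted_wrt)
  then have yb: "y \<le> ?b" by (auto simp: less_imp_le)
  obtain r where r: "x < r" "r < y" "poly p r = 0"
    using poly_IVT[OF xy] by blast
  \<comment> \<open>Since \<open>r < y\<close>, the new root is not among those counted beyond
    \<open>y\<close>, so it may be added without exceeding any multiplicity.\<close>
  have "{#r#} + ?I y ?b \<subseteq># ?I x ?b"
  proof (rule mset_subset_eqI)
    fix z
    have "0 < order r p" using r assms(1) by (simp add: order_root)
    then show "count ({#r#} + ?I y ?b) z \<le> count (?I x ?b) z"
      using r xy yb assms(1) by (auto simp: Suc_le_eq)
  qed
  from size_mset_mono[OF this] show ?case
    using Cons.IH[OF succ] by simp
qed

lemma sign_changes_le_pos_proots: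
  fixes p :: "real poly"
  assumes "p \<noteq> 0" "successively (\<lambda>x y. x < y \<and> poly p x * poly p y < 0) (0 # xs)"
  shows "length xs \<le> size {#z \<in># proots p. 0 < z#}"
proof -
  have "{#z \<in># proots p. 0 < z \<and> z < last (0 # xs)#} \<subseteq># {#z \<in># proots p. 0 < z#}"
    by (auto intro: mset_subset_eqI)
  from size_mset_mono[OF this] sign_changes_le_proots[OF assms] show ?thesis by linarith
qed

lemma sign_changes_le_neg_proots:
  fixes p :: "real poly"
  assumes "p \<noteq> 0" "successively (\<lambda>x y. x < y \<and> poly p x * poly p y < 0) (x # xs)"
    and "last (x # xs) = 0"
  shows "length xs \<le> size {#z \<in># proots p. z < 0#}"
proof -
  have "{#z \<in># proots p. x < z \<and> z < 0#} \<subseteq># {#z \<in># proots p. z < 0#}"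
    by (auto intro: mset_subset_eqI)
  from size_mset_mono[OF this] sign_changes_le_proots[OF assms(1,2)] assms(3)
  show ?thesis by simp
qed

section \<open>Adjacency matrix of a line graph from an edge list\<close>

text \<open>The pairs stand for unordered edges: the first two disjuncts say that the edges
  coincide, the last that they are disjoint.\<close>

definition line_rows :: "('a \<times> 'a) list \<Rightarrow> real list list" where
  "line_rows es = map (\<lambda>(i, j). map (\<lambda>(k, l).
     if i = k \<and> j = l \<or> i = l \<and> j = k \<or> i \<noteq> k \<and> i \<noteq> l \<and> j \<noteq> k \<and> j \<noteq> l
     then 0 else 1) es) es"

text \<open>Adjacency in the line graph depends only on which endpoints are equal, and the injective
  \<open>f\<close> preserves this. One matrix computed from labels thus serves every choice of
  distinct vertices.\<close>

lemma
  fixes f :: "'a \<Rightarrow> 'v"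
  assumes inj: "inj_on f S" and es: "set es \<subseteq> S \<times> S"
    and G: "G = graph_of_edges V (map_prod f f ` set es)"
  defines "vs \<equiv> map (\<lambda>(i, j). {f i, f j}) es"
  shows pverts_line_graph: "pverts (line_graph G) = set vs"
    and distinct_line_vertices: "distinct (map (\<lambda>(i, j). {i, j}) es) \<Longrightarrow> distinct vs"
    and adjacency_matrix_line_graph: "adjacency_matrix_wrt vs (line_graph G) = sq_mat (line_rows es)"
proof -
  have "edges G = set vs"
    unfolding edges_def G graph_of_edges_def vs_def
    by (force simp: map_prod_def insert_commute)
  then show pv: "pverts (line_graph G) = set vs"
    by (simp add: line_graph_def)
  \<comment> \<open>As images of label sets the edges stay distinct, because taking images under
    \<open>f\<close> is injective on subsets of \<open>S\<close>.\<close>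
  have vs: "vs = map ((`) f) (map (\<lambda>(i, j). {i, j}) es)"
    by (auto simp: vs_def)
  show "distinct vs" if "distinct (map (\<lambda>(i, j). {i, j}) es)"
    unfolding vs distinct_map[of "(`) f"]
  proof (intro conjI that)
    show "inj_on ((`) f) (set (map (\<lambda>(i, j). {i, j}) es))"
      by (rule inj_on_subset[OF inj_on_image_Pow[OF inj]]) (use es in auto)
  qed
  show "adjacency_matrix_wrt vs (line_graph G) = sq_mat (line_rows es)"
  proof (rule eq_matI)
    fix m n assume "m < dim_row (sq_mat (line_rows es))" "n < dim_col (sq_mat (line_rows es))"
    then have mn: "m < length es" "n < length es" by (simp_all add: line_rows_def)
    obtain i j k l where ij: "es ! m = (i, j)" and kl: "es ! n = (k, l)"
      by (metis surj_pair)
    have S: "i \<in> S" "j \<in> S" "k \<in> S" "l \<in> S"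
      using es mn nth_mem[of m es] nth_mem[of n es] ij kl by auto
    have f: "f x = f y \<longleftrightarrow> x = y" if "x \<in> S" "y \<in> S" for x y
      using inj that by (auto simp: inj_on_def)
    have "vs ! m \<in> pverts (line_graph G)" "vs ! n \<in> pverts (line_graph G)"
      using mn unfolding pv by (simp_all add: vs_def)
    then have "(vs ! m, vs ! n) \<in> parcs (line_graph G) \<longleftrightarrow>
        {f i, f j} \<noteq> {f k, f l} \<and> {f i, f j} \<inter> {f k, f l} \<noteq> {}"
      using mn ij kl by (auto simp: line_graph_def vs_def)
    then show "adjacency_matrix_wrt vs (line_graph G) $$ (m, n) = sq_mat (line_rows es) $$ (m, n)"
      using mn ij kl S
      by (auto simp: adjacency_matrix_wrt_def line_rows_def doubleton_eq_iff f vs_def)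
  qed (simp_all add: adjacency_matrix_wrt_def line_rows_def vs_def)
qed

section \<open>Connectedness\<close>

text \<open>Following descending arcs must end, and it can end only at \<open>r\<close>. Any two
  vertices are then joined through \<open>r\<close>, the second path being reversed by
  symmetry.\<close>

lemma connected_if_descending_arcs:
  fixes G :: "nat pair_pre_digraph"
  assumes G: "pair_graph G" and root: "r \<in> pverts G"
    and descend: "\<And>x. x \<in> pverts G \<Longrightarrow> x \<noteq> r \<Longrightarrow> \<exists>y<x. (x, y) \<in> parcs G"
  shows "Digraph_Component.connected (with_proj G)"
proof -
  interpret pair_graph G by fact
  have reach: "x \<rightarrow>\<^sup>*\<^bsub>with_proj G\<^esub> r" if "x \<in> pverts G" for x
    using that
  proof (induction x rule: less_induct)
    case (less x)
    show ?case
    proof (cases "x = r")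
      case True
      then show ?thesis using root by simp
    next
      case False
      then obtain y where y: "y < x" "(x, y) \<in> parcs G"
        using descend less.prems by blast
      then have "y \<in> pverts G" using y(2) in_arcsD2 by simp
      with y(1) have "y \<rightarrow>\<^sup>*\<^bsub>with_proj G\<^esub> r" by (rule less.IH)
      with y(2) show ?thesis by (rule adj_reachable_trans)
    qed
  qed
  show ?thesis
  proof (rule connectedI)
    show "pverts G \<noteq> {}" using root by auto
    fix x y assume "x \<in> pverts G" "y \<in> pverts G"
    then have "x \<rightarrow>\<^sup>*\<^bsub>with_proj G\<^esub> r" "y \<rightarrow>\<^sup>*\<^bsub>with_proj G\<^esub> r"
      by (simp_all add: reach)
    from reachable_trans[OF this(1) symmetric_reachable'[OF this(2)]]
    show "x \<rightarrow>\<^sup>*\<^bsub>mk_symmetric (with_proj G)\<^esub> y"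
      by (rule reachable_mk_symmetricI)
  qed
qed

section \<open>Block diagonalisation for \<open>G14\<close>\<close>

text \<open>The vertices \<open>a, b, c, d, u 0, \<dots>, u 4, v 0, \<dots>, v 4\<close> are numbered \<open>0, \<dots>, 13\<close>.\<close>

definition G14_edges :: "(nat \<times> nat) list" where
  "G14_edges = [(0, 1), (1, 2), (2, 3), (3, 0),
     (4, 5), (5, 6), (6, 7), (7, 8), (8, 4), (9, 10), (10, 11), (11, 12), (12, 13), (13, 9),
     (0, 4), (1, 9)]"

text \<open>
  The columns are, in this order: for each pentagon, the vectors on its edges that are odd under the
  reflection fixing the bridge; then the remaining vectors, invariant under both pentagon
  reflections, that are odd (five columns) and even (seven columns) under the symmetry swapping
  \<open>a\<close> with \<open>b\<close>, \<open>c\<close> with \<open>d\<close> and the two pentagons.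
  They are orthogonal, so the inverse is the transpose with rescaled rows.
\<close>

definition G14_basis :: "real list list" where
  "G14_basis = [
    [0, 0, 0, 0, 0, 0, 0, 0, 0, 0, 0, 0, 0, 1, 0, 0],
    [0, 0, 0, 0, 0, 0, 0, 0, -1, 0, 0, 0, 0, 0, 1, 0],
    [0, 0, 0, 0, 0, 0, 0, 0, 0, 0, 0, 0, 0, 0, 0, 1],
    [0, 0, 0, 0, 0, 0, 0, 0, 1, 0, 0, 0, 0, 0, 1, 0],
    [1, 0, 0, 0, 0, 0, 1, 0, 0, 0, 0, 1, 0, 0, 0, 0],
    [0, 1, 0, 0, 0, 1, 0, 0, 0, 0, 1, 0, 0, 0, 0, 0],
    [0, 0, 0, 0, 1, 0, 0, 0, 0, 1, 0, 0, 0, 0, 0, 0],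
    [0, -1, 0, 0, 0, 1, 0, 0, 0, 0, 1, 0, 0, 0, 0, 0],
    [-1, 0, 0, 0, 0, 0, 1, 0, 0, 0, 0, 1, 0, 0, 0, 0],
    [0, 0, 1, 0, 0, 0, -1, 0, 0, 0, 0, 1, 0, 0, 0, 0],
    [0, 0, 0, 1, 0, -1, 0, 0, 0, 0, 1, 0, 0, 0, 0, 0],
    [0, 0, 0, 0, -1, 0, 0, 0, 0, 1, 0, 0, 0, 0, 0, 0],
    [0, 0, 0, -1, 0, -1, 0, 0, 0, 0, 1, 0, 0, 0, 0, 0],
    [0, 0, -1, 0, 0, 0, -1, 0, 0, 0, 0, 1, 0, 0, 0, 0],
    [0, 0, 0, 0, 0, 0, 0, 1, 0, 0, 0, 0, 1, 0, 0, 0],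
    [0, 0, 0, 0, 0, 0, 0, -1, 0, 0, 0, 0, 1, 0, 0, 0]]"

definition G14_basis_inv :: "real list list" where
  "G14_basis_inv = [
    [0, 0, 0, 0, 1/2, 0, 0, 0, -1/2, 0, 0, 0, 0, 0, 0, 0],
    [0, 0, 0, 0, 0, 1/2, 0, -1/2, 0, 0, 0, 0, 0, 0, 0, 0],
    [0, 0, 0, 0, 0, 0, 0, 0, 0, 1/2, 0, 0, 0, -1/2, 0, 0],
    [0, 0, 0, 0, 0, 0, 0, 0, 0, 0, 1/2, 0, -1/2, 0, 0, 0],
    [0, 0, 0, 0, 0, 0, 1/2, 0, 0, 0, 0, -1/2, 0, 0, 0, 0],
    [0, 0, 0, 0, 0, 1/4, 0, 1/4, 0, 0, -1/4, 0, -1/4, 0, 0, 0],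
    [0, 0, 0, 0, 1/4, 0, 0, 0, 1/4, -1/4, 0, 0, 0, -1/4, 0, 0],
    [0, 0, 0, 0, 0, 0, 0, 0, 0, 0, 0, 0, 0, 0, 1/2, -1/2],
    [0, -1/2, 0, 1/2, 0, 0, 0, 0, 0, 0, 0, 0, 0, 0, 0, 0],
    [0, 0, 0, 0, 0, 0, 1/2, 0, 0, 0, 0, 1/2, 0, 0, 0, 0],
    [0, 0, 0, 0, 0, 1/4, 0, 1/4, 0, 0, 1/4, 0, 1/4, 0, 0, 0],
    [0, 0, 0, 0, 1/4, 0, 0, 0, 1/4, 1/4, 0, 0, 0, 1/4, 0, 0],
    [0, 0, 0, 0, 0, 0, 0, 0, 0, 0, 0, 0, 0, 0, 1/2, 1/2],
    [1, 0, 0, 0, 0, 0, 0, 0, 0, 0, 0, 0, 0, 0, 0, 0],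
    [0, 1/2, 0, 1/2, 0, 0, 0, 0, 0, 0, 0, 0, 0, 0, 0, 0],
    [0, 0, 1, 0, 0, 0, 0, 0, 0, 0, 0, 0, 0, 0, 0, 0]]"

text \<open>Column \<open>j\<close> of a block holds the coordinates of the image of its
  \<open>j\<close>-th basis vector. The larger blocks are not symmetric because the basis vectors
  differ in length.\<close>

definition G14_blocks :: "real list list list" where
  "G14_blocks = [
    [[-1, 1], [1, 0]],
    [[-1, 1], [1, 0]],
    [[0, 2, 0, 0, 0], [1, 0, 1, 0, 0], [0, 1, 1, 1, 0], [0, 0, 2, 0, 1], [0, 0, 0, 1, 0]],
    [[0, 2, 0, 0, 0, 0, 0], [1, 0, 1, 0, 0, 0, 0], [0, 1, 1, 1, 0, 0, 0], [0, 0, 2, 0, 1, 1, 0],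
     [0, 0, 0, 2, 0, 2, 0], [0, 0, 0, 1, 1, 0, 1], [0, 0, 0, 0, 0, 2, 0]]]"

lemma line_rows_similar: "rows_mult (rows_mult G14_basis (diag_rows G14_blocks)) G14_basis_inv
    = line_rows G14_edges"
  by (simp add: G14_basis_def G14_basis_inv_def G14_blocks_def G14_edges_def line_rows_def
      rows_mult_def Let_def numeral_eq_Suc)

lemma G14_basis_inverse: "rows_mult G14_basis G14_basis_inv
    = map (\<lambda>i. map (\<lambda>j. if i = j then 1 else 0) [0..<16]) [0..<16]"
  by (simp add: G14_basis_def G14_basis_inv_def rows_mult_def Let_def numeral_eq_Suc)

lemma square_G14:
  "length (line_rows G14_edges) = 16" "length G14_basis = 16" "length G14_basis_inv = 16" "length (diag_rows G14_blocks) = 16"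
  "square_rows G14_basis" "\<forall>M\<in>set G14_blocks. square_rows M"
  by (simp_all add: line_rows_def G14_edges_def G14_basis_def G14_basis_inv_def G14_blocks_def
      square_rows_def Let_def)

text \<open>The change of basis makes the adjacency matrix similar to the block diagonal one, and
  similar matrices share their characteristic polynomial.\<close>

lemma char_poly_line_rows_G14:
  "char_poly (sq_mat (line_rows G14_edges)) = (\<Prod>M\<leftarrow>G14_blocks. char_poly (sq_mat M))"
proof -
  let ?A = "sq_mat (line_rows G14_edges)" and ?D = "sq_mat (diag_rows G14_blocks)"
  let ?P = "sq_mat G14_basis" and ?Q = "sq_mat G14_basis_inv"
  have sq: "square_rows (rows_mult G14_basis (diag_rows G14_blocks))"
    using square_G14 by (simp add: square_rows_def rows_mult_def Let_def)
  have carrier: "?A \<in> carrier_mat 16 16" "?D \<in> carrier_mat 16 16"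
      "?P \<in> carrier_mat 16 16" "?Q \<in> carrier_mat 16 16"
    using sq_mat_carrier[of "line_rows G14_edges"] sq_mat_carrier[of "diag_rows G14_blocks"]
      sq_mat_carrier[of G14_basis] sq_mat_carrier[of G14_basis_inv]
    by (simp_all only: square_G14)
  have PQ: "?P * ?Q = 1\<^sub>m 16"
    by (subst sq_mat_mult) (auto simp: square_G14 G14_basis_inverse intro!: eq_matI)
  have "?P * ?D * ?Q = sq_mat (rows_mult (rows_mult G14_basis (diag_rows G14_blocks)) G14_basis_inv)"
    using square_G14 sq by (simp add: sq_mat_mult rows_mult_def Let_def)
  then have "?A = ?P * ?D * ?Q"
    by (simp only: line_rows_similar)
  then have "similar_mat ?A ?D"
    using carrier PQ mat_mult_left_right_inverse[OF carrier(3,4) PQ]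
    by (intro similar_matI[of _ _ ?P ?Q 16]) auto
  then show ?thesis
    using char_poly_similar char_poly_diag_rows square_G14(6) by metis
qed

text \<open>The last polynomial is kept factored: the roots -2 (twice), 1 and 2 can be read off, and
  only a cubic is left for sign changes.\<close>

lemma char_poly_blocks:
  "char_poly (sq_mat [[-1, 1], [1, 0 :: real]]) = [:-1, 1, 1:]"
  "char_poly (sq_mat [[0, 2, 0, 0, 0], [1, 0, 1, 0, 0], [0, 1, 1, 1, 0], [0, 0, 2, 0, 1],
     [0, 0, 0, 1, 0 :: real]]) = [:-2, 7, 3, -6, -1, 1:]"
  "char_poly (sq_mat
    [[0, 2, 0, 0, 0, 0, 0], [1, 0, 1, 0, 0, 0, 0], [0, 1, 1, 1, 0, 0, 0], [0, 0, 2, 0, 1, 1, 0],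
     [0, 0, 0, 2, 0, 2, 0], [0, 0, 0, 1, 1, 0, 1], [0, 0, 0, 0, 0, 2, 0 :: real]])
   = [:2, 1:] * [:2, 1:] * [:-1, 1:] * [:-2, 1:] * [:1, -4, -2, 1:]"
  by (simp_all add: char_poly_sq_mat char_rows_def numeral_eq_Suc)

lemma char_poly_G14:
  "char_poly (sq_mat (line_rows G14_edges)) = (\<Prod>p\<leftarrow>
     [[:-1, 1, 1:], [:-1, 1, 1:], [:-2, 7, 3, -6, -1, 1:],
      [:2, 1:], [:2, 1:], [:-1, 1:], [:-2, 1:], [:1, -4, -2, 1:]]. p)"
  unfolding char_poly_line_rows_G14 G14_blocks_def
  \<comment> \<open>Without the \<open>pCons\<close> multiplication rules the factors stay
    unexpanded and only have to be reordered.\<close>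
  by (simp add: char_poly_blocks ac_simps del: mult_pCons_left mult_pCons_right)

section \<open>Signs of the 16 eigenvalues\<close>

lemma proots_signs_G14:
  defines "p \<equiv> char_poly (sq_mat (line_rows G14_edges))"
  shows "size {#z \<in># proots p. 0 < z#} = 9"
    and "size {#z \<in># proots p. z = 0#} = 0"
    and "size {#z \<in># proots p. z < 0#} = 7"
proof -
  let ?q = "[:-1, 1, 1:] :: real poly" and ?r = "[:-2, 7, 3, -6, -1, 1:] :: real poly"
    and ?s = "[:1, -4, -2, 1:] :: real poly"
  have proots_p: "proots p = proots ?q + proots ?q + proots ?r + {#-2, -2, 1, 2#} + proots ?s"
    unfolding p_def char_poly_G14 by (subst proots_prod_list) (simp_all add: ac_simps)
  have pos: "1 \<le> size {#z \<in># proots ?q. 0 < z#}" "3 \<le> size {#z \<in># proots ?r. 0 < z#}"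
    "2 \<le> size {#z \<in># proots ?s. 0 < z#}"
    using sign_changes_le_pos_proots[of ?q "[1]"] sign_changes_le_pos_proots[of ?r "[1, 2, 3]"]
      sign_changes_le_pos_proots[of ?s "[1, 4]"] by simp_all
  have neg: "1 \<le> size {#z \<in># proots ?q. z < 0#}" "2 \<le> size {#z \<in># proots ?r. z < 0#}"
    "1 \<le> size {#z \<in># proots ?s. z < 0#}"
    using sign_changes_le_neg_proots[of ?q "-2" "[0]"]
      \<comment> \<open>\<open>?r\<close> is negative at -2, -1 and 0, so integer points in this
        range miss its two roots there; at -3/2 its value is 59/32.\<close>
      sign_changes_le_neg_proots[of ?r "-2" "[-3/2, 0]"]
      sign_changes_le_neg_proots[of ?s "-2" "[0]"] by simp_all
  have "degree p = 16"
    using degree_monic_char_poly[OF sq_mat_carrier[of "line_rows G14_edges"]]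
    by (simp add: p_def square_G14)
  then have "size (proots p) \<le> 16"
    using size_proots_le[of p] by simp
  moreover have "proots p = {#z \<in># proots p. 0 < z#} + {#z \<in># proots p. z = 0#}
      + {#z \<in># proots p. z < 0#}"
    by (rule multiset_eqI) auto
  then have "size (proots p) = size {#z \<in># proots p. 0 < z#} + size {#z \<in># proots p. z = 0#}
      + size {#z \<in># proots p. z < 0#}"
    by (metis size_union)
  \<comment> \<open>In the order of the summands of \<open>proots_p\<close>, the positive roots
    number at least 1 + 1 + 3 + 2 + 2 and the negative ones at least 1 + 1 + 2 + 2 + 1. With at most
    16 roots in all, both bounds are attained and 0 is not a root.\<close>
  moreover have "9 \<le> size {#z \<in># proots p. 0 < z#}" "7 \<le> size {#z \<in># proots p. z < 0#}"
    using pos neg by (simp_all add: proots_p)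
  ultimately show "size {#z \<in># proots p. 0 < z#} = 9"
    and "size {#z \<in># proots p. z = 0#} = 0"
    and "size {#z \<in># proots p. z < 0#} = 7"
    by linarith+
qed

section \<open>Inertia and the counterexample\<close>

lemma G14_eq_graph_of_edges:
  fixes a b c d :: 'v and u v :: "nat \<Rightarrow> 'v"
  defines "w \<equiv> [a, b, c, d, u 0, u 1, u 2, u 3, u 4, v 0, v 1, v 2, v 3, v 4]"
  shows "G14 a b c d u v = graph_of_edges (set w) (map_prod ((!) w) ((!) w) ` set G14_edges)"
  unfolding G14_def w_def G14_edges_def
  by (rule arg_cong2[of _ _ _ _ graph_of_edges]) auto

lemma inertia_line_graph_G14:
  fixes a b c d :: 'v and u v :: "nat \<Rightarrow> 'v"
  assumes "distinct [a, b, c, d, u 0, u 1, u 2, u 3, u 4, v 0, v 1, v 2, v 3, v 4]"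
  shows "inertia (line_graph (G14 a b c d u v)) = (9, 0, 7)"
proof -
  define w where "w = [a, b, c, d, u 0, u 1, u 2, u 3, u 4, v 0, v 1, v 2, v 3, v 4]"
  define vs where "vs = map (\<lambda>(i, j). {w ! i, w ! j}) G14_edges"
  let ?H = "line_graph (G14 a b c d u v)"
  have inj: "inj_on ((!) w) {..<14}"
    using assms by (intro inj_on_nth) (auto simp: w_def)
  have es: "set G14_edges \<subseteq> {..<14} \<times> {..<14}"
    by (simp add: G14_edges_def)
  have G: "G14 a b c d u v = graph_of_edges (set w) (map_prod ((!) w) ((!) w) ` set G14_edges)"
    unfolding w_def by (rule G14_eq_graph_of_edges)
  have "distinct (map (\<lambda>(i, j). {i, j}) G14_edges)"
    by (simp add: G14_edges_def doubleton_eq_iff)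
  then have vs: "distinct vs" "set vs = pverts ?H"
    and adj: "adjacency_matrix_wrt vs ?H = sq_mat (line_rows G14_edges)"
    unfolding vs_def
    using distinct_line_vertices[OF inj es G] pverts_line_graph[OF inj es G]
      adjacency_matrix_line_graph[OF inj es G] by simp_all
  show ?thesis
    \<comment> \<open>\<open>eigenvalue_count_wrt\<close> replaces the arbitrary enumeration in
      \<open>adjacency_matrix\<close> by \<open>vs\<close>, for which the matrix is
      explicit.\<close>
    unfolding inertia_def n_pos_def n_zero_def n_neg_def eigenvalue_count_wrt[OF vs] adj
      eigenvalue_count_proots[OF sq_mat_carrier] proots_signs_G14 ..
qed

theorem proposition2:
  fixes a b c d :: 'v and u v :: "nat \<Rightarrow> 'v"
  assumes "distinct [a, b, c, d, u 0, u 1, u 2, u 3, u 4, v 0, v 1, v 2, v 3, v 4]"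
  shows "inertia (line_graph (G14 a b c d u v)) = (9, 0, 7) \<and>
         signature (line_graph (G14 a b c d u v)) = 2 \<and>
         \<not> (\<forall>G :: nat pair_pre_digraph.
               pair_graph G \<and> Digraph_Component.connected (with_proj G) \<longrightarrow>
               n_pos (line_graph G) \<le> n_neg (line_graph G) + 1)"
proof (intro conjI notI)
  show inertia: "inertia (line_graph (G14 a b c d u v)) = (9, 0, 7)"
    using assms by (rule inertia_line_graph_G14)
  then show "signature (line_graph (G14 a b c d u v)) = 2"
    by (simp add: inertia_def signature_def)
  let ?G = "G14 0 1 2 3 (\<lambda>i. 4 + i) (\<lambda>i. 9 + i) :: nat pair_pre_digraph"
  have distinct: "distinct [0, 1, 2, 3, 4 + 0, 4 + 1, 4 + 2, 4 + 3, 4 + 4,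
      9 + 0, 9 + 1, 9 + 2, 9 + 3, 9 + 4 :: nat]"
    by simp
  have pair_graph: "pair_graph ?G"
    using distinct by (rule pair_graph_G14)
  have "Digraph_Component.connected (with_proj ?G)"
  proof (rule connected_if_descending_arcs[OF pair_graph])
    show "0 \<in> pverts ?G"
      by (simp add: G14_def graph_of_edges_def)
    fix x assume "x \<in> pverts ?G" "x \<noteq> 0"
    then have "x \<in> {1, 2, 3, 9, 10, 11, 12, 13, 4, 5, 6, 7, 8}"
      by (simp add: G14_def graph_of_edges_def) blast
    \<comment> \<open>The parent of \<open>x\<close> in a spanning tree rooted at 0: the bridges
      lead from 9 to 1 and from 4 to 0, the square edge \<open>da\<close> from 3 to 0, and every
      other vertex goes to its predecessor on its cycle.\<close>
    moreover define y where "y = (if x = 9 then 1 else if x \<in> {3, 4} then 0 else x - 1)"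
    ultimately have "y < x \<and> (x, y) \<in> parcs ?G"
      unfolding G14_def graph_of_edges_def by (elim insertE) simp_all
    then show "\<exists>y<x. (x, y) \<in> parcs ?G" by blast
  qed
  moreover assume "\<forall>G :: nat pair_pre_digraph.
    pair_graph G \<and> Digraph_Component.connected (with_proj G) \<longrightarrow>
    n_pos (line_graph G) \<le> n_neg (line_graph G) + 1"
  ultimately have "n_pos (line_graph ?G) \<le> n_neg (line_graph ?G) + 1"
    using pair_graph by blast
  moreover have "inertia (line_graph ?G) = (9, 0, 7)"
    using distinct by (rule inertia_line_graph_G14)
  ultimately show False
    by (simp add: inertia_def)
qed

end
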